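(* Let $G$ be a connected graph and let $v\in V(G)$ be a vertex that is not a cut vertex of $G$. Then $$\chi'^t_d(G)-\deg(v)\leq \chi'^t_d(G-v)\leq \chi'^t_d(G)+\deg(v).$$
   Context: Graphs are simple. Two edges are adjacent if they are distinct and share an endpoint. A total dominator edge coloring (TDE-coloring) of a graph $G$ is a proper edge coloring of $G$ in which each edge of $G$ is adjacent to every edge of some color class (a color class is the set of all edges assigned a given used color). The total dominator edge chromatic number $\chi'^t_d(G)$ is the minimum number of color classes in a TDE-coloring of $G$. $G-v$ is the graph obtained from $G$ by deleting the vertex $v$ and all edges incident to $v$; $\deg(v)$ is the degree of $v$ in $G$.
   Formalization: It is additionally assumed that both G and G−v have a TDE-coloring, so that both chromatic numbers exist; this excludes only G = K2, G = K3, and G = P3 with v a leaf, where one of the numbers is undefined. *)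

theory Defs
  imports Main
begin

record 'a sgraph =
  verts :: "'a set"
  edges :: "'a set set"

definition simple_graph :: "'a sgraph \<Rightarrow> bool" where
  "simple_graph G \<longleftrightarrow> finite (verts G) \<and> (\<forall>e\<in>edges G. e \<subseteq> verts G \<and> card e = 2)"

definition vert_adj :: "'a sgraph \<Rightarrow> ('a \<times> 'a) set" where
  "vert_adj G = {(x, y). {x, y} \<in> edges G}"

definition joined :: "'a sgraph \<Rightarrow> ('a \<times> 'a) set" where
  "joined G = {(x, y). x \<in> verts G \<and> y \<in> verts G \<and> (x, y) \<in> (vert_adj G)\<^sup>*}"

definition components :: "'a sgraph \<Rightarrow> 'a set set" where
  "components G = verts G // joined G"

definition connected_graph :: "'a sgraph \<Rightarrow> bool" where
  "connected_graph G \<longleftrightarrow> verts G \<noteq> {} \<and> (\<forall>x\<in>verts G. \<forall>y\<in>verts G. (x, y) \<in> joined G)"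

definition delete_vertex :: "'a sgraph \<Rightarrow> 'a \<Rightarrow> 'a sgraph" where
  "delete_vertex G v = \<lparr>verts = verts G - {v}, edges = {e \<in> edges G. v \<notin> e}\<rparr>"

definition cut_vertex :: "'a sgraph \<Rightarrow> 'a \<Rightarrow> bool" where
  "cut_vertex G v \<longleftrightarrow> v \<in> verts G \<and> card (components G) < card (components (delete_vertex G v))"

definition degree :: "'a sgraph \<Rightarrow> 'a \<Rightarrow> nat" where
  "degree G v = card {e \<in> edges G. v \<in> e}"

definition edge_adj :: "'a set \<Rightarrow> 'a set \<Rightarrow> bool" where
  "edge_adj e e' \<longleftrightarrow> e \<noteq> e' \<and> e \<inter> e' \<noteq> {}"

definition proper_edge_coloring :: "'a sgraph \<Rightarrow> ('a set \<Rightarrow> 'c) \<Rightarrow> bool" where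
  "proper_edge_coloring G f \<longleftrightarrow>
     (\<forall>e\<in>edges G. \<forall>e'\<in>edges G. edge_adj e e' \<longrightarrow> f e \<noteq> f e')"

definition color_classes :: "'a sgraph \<Rightarrow> ('a set \<Rightarrow> 'c) \<Rightarrow> 'a set set set" where
  "color_classes G f = (\<lambda>c. {e \<in> edges G. f e = c}) ` (f ` edges G)"

definition tde_coloring :: "'a sgraph \<Rightarrow> ('a set \<Rightarrow> 'c) \<Rightarrow> bool" where
  "tde_coloring G f \<longleftrightarrow> proper_edge_coloring G f \<and>
     (\<forall>e\<in>edges G. \<exists>C\<in>color_classes G f. \<forall>e'\<in>C. edge_adj e e')"

text \<open>Natural numbers suffice as colors, since the graphs considered are finite.\<close>

definition tde_colorable :: "'a sgraph \<Rightarrow> bool" where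
  "tde_colorable G \<longleftrightarrow> (\<exists>f :: 'a set \<Rightarrow> nat. tde_coloring G f)"

text \<open>
  The minimum exists only for graphs that have a TDE-coloring at all; for other graphs
  (those with a connected component that is a single edge) the value below is unspecified.
\<close>

definition tde_chromatic_number :: "'a sgraph \<Rightarrow> nat" where
  "tde_chromatic_number G =
     (LEAST n. \<exists>f :: 'a set \<Rightarrow> nat. tde_coloring G f \<and> card (color_classes G f) = n)"

lemma tde_colorable_iff:
  assumes "simple_graph G"
  shows "tde_colorable G \<longleftrightarrow> (\<forall>e\<in>edges G. \<exists>e'\<in>edges G. edge_adj e e')"
proof
  assume "tde_colorable G"
  then show "\<forall>e\<in>edges G. \<exists>e'\<in>edges G. edge_adj e e'"
    unfolding tde_colorable_def tde_coloring_def color_classes_def by fastforce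
next
  assume isol: "\<forall>e\<in>edges G. \<exists>e'\<in>edges G. edge_adj e e'"
  have "edges G \<subseteq> Pow (verts G)" and "finite (verts G)"
    using assms by (auto simp: simple_graph_def)
  then have "finite (edges G)"
    by (meson finite_Pow_iff finite_subset)
  then obtain f :: "'a set \<Rightarrow> nat" where inj: "inj_on f (edges G)"
    using finite_imp_inj_to_nat_seg by metis
  have "proper_edge_coloring G f"
    using inj by (auto simp: proper_edge_coloring_def edge_adj_def inj_on_def)
  moreover have "\<exists>C\<in>color_classes G f. \<forall>e''\<in>C. edge_adj e e''" if "e \<in> edges G" for e
  proof -
    obtain e' where e': "e' \<in> edges G" "edge_adj e e'"
      using isol \<open>e \<in> edges G\<close> by blast
    have "{d \<in> edges G. f d = f e'} = {e'}"
      using inj e'(1) by (auto simp: inj_on_def)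
    then have "{e'} \<in> color_classes G f"
      using e'(1) unfolding color_classes_def by blast
    then show ?thesis
      using e'(2) by blast
  qed
  ultimately show "tde_colorable G"
    unfolding tde_colorable_def tde_coloring_def by blast
qed

end

theory Submission
  imports Defs
begin

text \<open>
  Everything rests on one operation: turning each edge of a set \<open>S\<close> into a color class of its
  own. Splitting classes never destroys domination, since an edge adjacent to a whole class is
  adjacent to every part of it, and an edge of \<open>S\<close> dominates all its neighbors. The price is
  at most \<open>card S\<close> further colors (lemma \<open>tde_chromatic_number_le_single_out\<close>).

  For the first inequality, extend an optimal coloring of \<open>G - v\<close>. If \<open>deg v \<ge> 2\<close>, the edges
  at \<open>v\<close> become singleton classes and dominate one another. If \<open>v\<close> has a single edge \<open>vu\<close>, a
  singleton class \<open>{vu}\<close> would leave \<open>vu\<close> itself possibly undominated. Instead pick another edge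
  \<open>a\<close> at \<open>u\<close>, which exists because \<open>vu\<close> is dominated in some coloring of \<open>G\<close>; let \<open>vu\<close>
  inherit the color of \<open>a\<close>, and make \<open>{a}\<close> the new class. It dominates \<open>vu\<close> and also every
  edge that was dominated by the old class of \<open>a\<close>, the only class that has changed.

  For the second inequality, restrict an optimal coloring of \<open>G\<close> to \<open>G - v\<close>. Domination by a
  class survives unless the class disappears, that is, unless it is a singleton \<open>{vu}\<close>; only
  edges at \<open>u\<close> depended on it. For every such \<open>u\<close> with an edge \<open>a\<close> remaining, single out \<open>a\<close>
  together with some edge \<open>b\<close> of \<open>G - v\<close> adjacent to \<open>a\<close>, which exists because \<open>G - v\<close> has a
  TDE-coloring: then \<open>{a}\<close> dominates the other edges at \<open>u\<close>, and \<open>{b}\<close> dominates \<open>a\<close>. With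
  \<open>k\<close> lost classes this costs at most \<open>2 * k\<close> new ones, hence a net increase of at most \<open>k \<le> deg v\<close>.
\<close>

section \<open>Color classes as fibers\<close>

definition dominated :: "'a set set \<Rightarrow> ('a set \<Rightarrow> 'c) \<Rightarrow> 'a set \<Rightarrow> bool" where
  "dominated E f e \<longleftrightarrow> (\<exists>a\<in>E. \<forall>e'\<in>E. f e' = f a \<longrightarrow> edge_adj e e')"

lemma tde_coloring_iff_dominated:
  "tde_coloring G f \<longleftrightarrow>
     proper_edge_coloring G f \<and> (\<forall>e\<in>edges G. dominated (edges G) f e)"
  unfolding tde_coloring_def dominated_def color_classes_def
  by (simp add: Ball_def imp_conjL)

lemma card_color_classes: "card (color_classes G f) = card (f ` edges G)"
  unfolding color_classes_def by (rule card_image) (auto simp: inj_on_def)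

lemma edge_adj_commute: "edge_adj e e' \<longleftrightarrow> edge_adj e' e"
  by (auto simp: edge_adj_def)

lemma edge_adj_via_other_endpoint:
  assumes "card s = 2" and "v \<in> s" and "v \<notin> e" and "v \<notin> e'"
    and "edge_adj s e" and "edge_adj s e'" and "e \<noteq> e'"
  shows "edge_adj e e'"
proof -
  have "card (s - {v}) = 1"
    using assms(1,2) by simp
  then obtain u where "s - {v} = {u}"
    by (rule card_1_singletonE)
  then have "s = {v, u}"
    using assms(2) insert_Diff[of v s] by simp
  then have "u \<in> e" "u \<in> e'"
    using assms(3-6) by (simp_all add: edge_adj_def)
  then show ?thesis
    using assms(7) by (auto simp: edge_adj_def)
qed

lemma card_edge: "simple_graph G \<Longrightarrow> e \<in> edges G \<Longrightarrow> card e = 2"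
  by (simp add: simple_graph_def)

lemma finite_edges: "simple_graph G \<Longrightarrow> finite (edges G)"
  by (rule finite_subset[of _ "Pow (verts G)"]) (auto simp: simple_graph_def)

lemma edges_delete_vertex: "edges (delete_vertex G v) = edges G - {e \<in> edges G. v \<in> e}"
  by (auto simp: delete_vertex_def)

text \<open>
  Colors of any type may be used in upper bounds, because only finitely many of them occur and
  these can be renamed to natural numbers.
\<close>

lemma tde_chromatic_number_le:
  fixes f :: "'a set \<Rightarrow> 'c"
  assumes "finite (edges G)" and tde: "tde_coloring G f"
  shows "tde_chromatic_number G \<le> card (f ` edges G)"
proof -
  obtain h :: "'c \<Rightarrow> nat" where h: "inj_on h (f ` edges G)"
    using finite_imp_inj_to_nat_seg[of "f ` edges G"] assms(1) by auto
  have eq: "(h \<circ> f) e = (h \<circ> f) e' \<longleftrightarrow> f e = f e'" if "e \<in> edges G" "e' \<in> edges G" for e e'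
    using h that by (auto simp: inj_on_def)
  have "tde_coloring G (h \<circ> f)"
    using tde unfolding tde_coloring_iff_dominated proper_edge_coloring_def dominated_def
    by (simp add: eq del: comp_apply cong: ball_cong bex_cong)
  moreover have "card (color_classes G (h \<circ> f)) = card (f ` edges G)"
    unfolding card_color_classes image_comp[symmetric] using h by (rule card_image)
  ultimately show ?thesis
    unfolding tde_chromatic_number_def by (intro Least_le) blast
qed

lemma tde_chromatic_number_attained:
  assumes "tde_colorable G"
  obtains f :: "'a set \<Rightarrow> nat" where
    "tde_coloring G f" and "tde_chromatic_number G = card (f ` edges G)"
proof -
  have "\<exists>n. \<exists>f :: 'a set \<Rightarrow> nat. tde_coloring G f \<and> card (color_classes G f) = n"
    using assms by (auto simp: tde_colorable_def)
  from LeastI_ex[OF this] obtain f :: "'a set \<Rightarrow> nat"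
    where "tde_coloring G f" "card (color_classes G f) = tde_chromatic_number G"
    unfolding tde_chromatic_number_def by blast
  then show ?thesis
    using that by (simp add: card_color_classes)
qed

section \<open>Singling out edges\<close>

text \<open>
  The given coloring matters only outside \<open>S\<close>. Keeping the new colors apart from the old ones
  is the purpose of the sum type in the proof.
\<close>

lemma tde_chromatic_number_le_single_out:
  fixes f :: "'a set \<Rightarrow> 'c"
  assumes fin: "finite (edges G)" and S: "S \<subseteq> edges G"
    and proper: "\<And>e e'. \<lbrakk>e \<in> edges G - S; e' \<in> edges G - S; edge_adj e e'\<rbrakk> \<Longrightarrow> f e \<noteq> f e'"
    and dom: "\<And>e. e \<in> edges G \<Longrightarrow> (\<exists>a\<in>S. edge_adj e a) \<or> dominated (edges G - S) f e"
  shows "tde_chromatic_number G \<le> card S + card (f ` (edges G - S))"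
proof -
  define g :: "'a set \<Rightarrow> 'c + 'a set"
    where "g e = (if e \<in> S then Inr e else Inl (f e))" for e
  have "proper_edge_coloring G g"
    using proper by (auto simp: proper_edge_coloring_def g_def edge_adj_def)
  moreover have "dominated (edges G) g e" if e: "e \<in> edges G" for e
    using dom[OF e]
  proof
    assume "\<exists>a\<in>S. edge_adj e a"
    then show ?thesis
      using S unfolding dominated_def g_def by (metis Inr_inject Inl_Inr_False subsetD)
  next
    assume "dominated (edges G - S) f e"
    then obtain a where "a \<in> edges G - S"
      and "\<forall>e'\<in>edges G - S. f e' = f a \<longrightarrow> edge_adj e e'"
      unfolding dominated_def by blast
    then show ?thesis
      unfolding dominated_def g_def by (intro bexI[of _ a]) auto
  qed
  ultimately have "tde_chromatic_number G \<le> card (g ` edges G)"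
    using fin by (intro tde_chromatic_number_le) (auto simp: tde_coloring_iff_dominated)
  also have "g ` edges G = Inr ` S \<union> Inl ` f ` (edges G - S)"
    using S by (auto simp: g_def image_iff)
  also have "card \<dots> \<le> card (Inr ` S :: ('c + 'a set) set)
      + card (Inl ` f ` (edges G - S) :: ('c + 'a set) set)"
    by (rule card_Un_le)
  also have "\<dots> = card S + card (f ` (edges G - S))"
    by (simp add: card_image)
  finally show ?thesis .
qed

section \<open>Adding a vertex\<close>

lemma tde_chromatic_number_le_delete_vertex:
  assumes G: "simple_graph G" and col: "tde_colorable G"
    and colH: "tde_colorable (delete_vertex G v)"
  shows "tde_chromatic_number G \<le> tde_chromatic_number (delete_vertex G v) + degree G v"
proof -
  define S where "S = {e \<in> edges G. v \<in> e}"
  have E_H: "edges (delete_vertex G v) = edges G - S"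
    by (simp add: edges_delete_vertex S_def)
  have fin: "finite (edges G)" and S: "S \<subseteq> edges G"
    using G finite_edges by (auto simp: S_def)
  obtain f :: "'a set \<Rightarrow> nat" where tde: "tde_coloring (delete_vertex G v) f"
    and num: "tde_chromatic_number (delete_vertex G v) = card (f ` (edges G - S))"
    using tde_chromatic_number_attained[OF colH] unfolding E_H by blast
  have proper: "f e \<noteq> f e'" if "e \<in> edges G - S" "e' \<in> edges G - S" "edge_adj e e'" for e e'
    using tde that by (auto simp: tde_coloring_def proper_edge_coloring_def E_H)
  have dom: "dominated (edges G - S) f e" if "e \<in> edges G - S" for e
    using tde that by (auto simp: tde_coloring_iff_dominated E_H)
  show ?thesis
  proof (cases "\<exists>s. S = {s}")
    case False
    have "\<exists>a\<in>S. edge_adj e a" if "e \<in> S" for e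
    proof -
      have "S \<noteq> {e}"
        using False by simp
      then obtain a where "a \<in> S" "a \<noteq> e"
        using \<open>e \<in> S\<close> by blast
      then show ?thesis
        using that by (auto simp: S_def edge_adj_def)
    qed
    then have "(\<exists>a\<in>S. edge_adj e a) \<or> dominated (edges G - S) f e" if "e \<in> edges G" for e
      using dom that by blast
    then have "tde_chromatic_number G \<le> card S + card (f ` (edges G - S))"
      using tde_chromatic_number_le_single_out[OF fin S proper] by simp
    then show ?thesis
      by (simp add: num degree_def S_def)
  next
    case True
    then obtain s where s: "S = {s}"
      by blast
    then have "s \<in> S"
      by simp
    then have s_at_v: "s \<in> edges G" "v \<in> s"
      unfolding S_def by auto
    have avoid_v: "v \<notin> e" if "e \<in> edges G - S" for e
      using that by (simp add: S_def)
    obtain a where "a \<in> edges G" and adj: "edge_adj s a"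
      using col s_at_v(1) unfolding tde_colorable_iff[OF G] by blast
    then have a: "a \<in> edges G - S"
      using s by (auto simp: edge_adj_def)
    define f' where "f' = f(s := f a)"
    \<comment> \<open>Edges meeting \<open>s\<close> meet it in its endpoint other than \<open>v\<close>, where \<open>a\<close> is the only edge
      of \<open>G - v\<close> with its color.\<close>
    have meet_a: "edge_adj e a" if e: "e \<in> edges G - S" "e \<noteq> a" "edge_adj s e" for e
      using edge_adj_via_other_endpoint[of s v e a] e a adj s_at_v avoid_v card_edge[OF G]
      by blast
    have "tde_chromatic_number G \<le> card {a} + card (f' ` (edges G - {a}))"
    proof (rule tde_chromatic_number_le_single_out[OF fin])
      show "{a} \<subseteq> edges G"
        using a by simp
    next
      fix e e' assume ee': "e \<in> edges G - {a}" "e' \<in> edges G - {a}" "edge_adj e e'"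
      have s_ne: "f a \<noteq> f x" if "x \<in> edges G - {a}" "edge_adj s x" for x
      proof -
        have "x \<in> edges G - S"
          using that s by (auto simp: edge_adj_def)
        then have "edge_adj x a"
          using that meet_a by blast
        then show ?thesis
          using proper[OF \<open>x \<in> edges G - S\<close> a] by simp
      qed
      consider "e = s" "e' \<noteq> s" | "e' = s" "e \<noteq> s" | "e \<noteq> s" "e' \<noteq> s"
        using ee' by (auto simp: edge_adj_def)
      then show "f' e \<noteq> f' e'"
      proof cases
        case 1
        then show ?thesis
          using s_ne[of e'] ee' by (simp add: f'_def)
      next
        case 2
        then show ?thesis
          using s_ne[of e] ee' edge_adj_commute[of e] by (simp add: f'_def)
      next
        case 3
        then show ?thesis
          using proper[of e e'] ee' s by (simp add: f'_def)
      qed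
    next
      fix e assume e: "e \<in> edges G"
      show "(\<exists>b\<in>{a}. edge_adj e b) \<or> dominated (edges G - {a}) f' e"
      proof (cases "e = s")
        case True
        then show ?thesis
          using adj by simp
      next
        case False
        then obtain b where b: "b \<in> edges G - S"
          and b_dom: "\<forall>e'\<in>edges G - S. f e' = f b \<longrightarrow> edge_adj e e'"
          using dom[of e] e s unfolding dominated_def by auto
        show ?thesis
        proof (cases "f b = f a")
          case True
          then show ?thesis
            using a b_dom by simp
        next
          case False
          then have "dominated (edges G - {a}) f' e"
            unfolding dominated_def using b b_dom s
            by (intro bexI[of _ b]) (auto simp: f'_def)
          then show ?thesis ..
        qed
      qed
    qed
    also have "f' ` (edges G - {a}) \<subseteq> f ` (edges G - S)"
      using a s by (auto simp: f'_def)
    then have "card {a} + card (f' ` (edges G - {a})) \<le> 1 + card (f ` (edges G - S))"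
      using fin by (simp add: card_mono)
    also have "\<dots> = tde_chromatic_number (delete_vertex G v) + degree G v"
      using s by (simp add: num degree_def S_def)
    finally show ?thesis .
  qed
qed

section \<open>Removing a vertex\<close>

lemma tde_chromatic_number_delete_vertex_le:
  assumes G: "simple_graph G" and col: "tde_colorable G"
    and colH: "tde_colorable (delete_vertex G v)"
  shows "tde_chromatic_number (delete_vertex G v) \<le> tde_chromatic_number G + degree G v"
proof -
  define H where "H = delete_vertex G v"
  have E_H: "edges H = {e \<in> edges G. v \<notin> e}"
    by (simp add: H_def delete_vertex_def)
  have fin: "finite (edges G)" and finH: "finite (edges H)"
    using finite_edges[OF G] by (auto simp: E_H)
  have simpleH: "simple_graph H"
    using G by (auto simp: simple_graph_def H_def delete_vertex_def)
  obtain f :: "'a set \<Rightarrow> nat" where tde: "tde_coloring G f"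
    and num: "tde_chromatic_number G = card (f ` edges G)"
    using tde_chromatic_number_attained[OF col] by blast
  have proper: "f e \<noteq> f e'" if "e \<in> edges G" "e' \<in> edges G" "edge_adj e e'" for e e'
    using tde that by (auto simp: tde_coloring_def proper_edge_coloring_def)
  \<comment> \<open>By properness, the color of an edge at \<open>v\<close> is lost exactly if the edge forms a class.\<close>
  define K where "K = {s \<in> edges G. v \<in> s \<and> f s \<notin> f ` edges H}"
  have K_deg: "card K \<le> degree G v"
    unfolding degree_def K_def using fin by (intro card_mono) auto
  have "inj_on f K"
  proof (rule inj_onI)
    fix s t assume "s \<in> K" "t \<in> K" "f s = f t"
    then show "s = t"
      using proper[of s t] by (auto simp: K_def edge_adj_def)
  qed
  moreover have "f ` edges H \<inter> f ` K = {}"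
  proof (rule equals0I)
    fix x assume "x \<in> f ` edges H \<inter> f ` K"
    then obtain s where "s \<in> K" "x = f s" and "x \<in> f ` edges H"
      by (elim IntE imageE[of x f K])
    then show False
      by (simp add: K_def)
  qed
  moreover have "finite K"
    using fin by (simp add: K_def)
  ultimately have "card (f ` edges H) + card K = card (f ` edges H \<union> f ` K)"
    using finH by (simp add: card_Un_disjoint card_image)
  also have "\<dots> \<le> card (f ` edges G)"
    using fin by (intro card_mono) (auto simp: K_def E_H)
  finally have lost: "card (f ` edges H) + card K \<le> tde_chromatic_number G"
    by (simp add: num)
  define a where "a s = (SOME a. a \<in> edges H \<and> edge_adj s a)" for s
  define b where "b s = (SOME b. b \<in> edges H \<and> edge_adj (a s) b)" for s
  have a: "a s \<in> edges H \<and> edge_adj s (a s)" if "e \<in> edges H" "edge_adj s e" for s e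
    unfolding a_def by (rule someI[of _ e]) (simp add: that)
  have b: "b s \<in> edges H \<and> edge_adj (a s) (b s)" if "a s \<in> edges H" for s
  proof -
    have "\<forall>e\<in>edges H. \<exists>e'\<in>edges H. edge_adj e e'"
      using colH tde_colorable_iff[OF simpleH] by (simp add: H_def)
    then have "\<exists>b. b \<in> edges H \<and> edge_adj (a s) b"
      using that by blast
    then show ?thesis
      unfolding b_def by (rule someI_ex)
  qed
  \<comment> \<open>If no edge of \<open>H\<close> meets \<open>s\<close>, then \<open>a s\<close> and \<open>b s\<close> are arbitrary; the intersection
    discards such values.\<close>
  define S where "S = (a ` K \<union> b ` K) \<inter> edges H"
  have "card S \<le> card (a ` K \<union> b ` K)"
    unfolding S_def using \<open>finite K\<close> by (intro card_mono) auto
  also have "\<dots> \<le> card K + card K"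
    by (rule order_trans[OF card_Un_le]) (intro add_mono card_image_le \<open>finite K\<close>)
  finally have card_S: "card S \<le> card K + card K" .
  have dom: "(\<exists>x\<in>S. edge_adj e x) \<or> dominated (edges H - S) f e" if e: "e \<in> edges H" for e
  proof -
    obtain c where c: "c \<in> edges G" and c_dom: "\<forall>e'\<in>edges G. f e' = f c \<longrightarrow> edge_adj e e'"
      using tde e unfolding tde_coloring_iff_dominated dominated_def E_H by blast
    show ?thesis
    proof (cases "f c \<in> f ` edges H")
      case True
      then obtain d where d: "d \<in> edges H" "f d = f c"
        by auto
      show ?thesis
      proof (cases "d \<in> S")
        case True
        then show ?thesis
          using c_dom d by (auto simp: E_H)
      next
        case False
        then have "dominated (edges H - S) f e"
          unfolding dominated_def using d c_dom
          by (intro bexI[of _ d]) (auto simp: E_H)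
        then show ?thesis ..
      qed
    next
      case False
      then have "v \<in> c"
        using c by (auto simp: E_H)
      then have cK: "c \<in> K"
        using False c by (simp add: K_def)
      have ce: "edge_adj c e"
        using c_dom c by (simp add: edge_adj_commute)
      have ac: "a c \<in> edges H" "edge_adj c (a c)"
        using a[OF e ce] by auto
      have bc: "b c \<in> edges H" "edge_adj (a c) (b c)"
        using b[OF ac(1)] by auto
      have in_S: "a c \<in> S" "b c \<in> S"
        using cK ac bc by (auto simp: S_def)
      show ?thesis
      proof (cases "e = a c")
        case True
        then show ?thesis
          using bc in_S by blast
      next
        case False
        \<comment> \<open>Both \<open>e\<close> and \<open>a c\<close> avoid \<open>v\<close>, so they meet \<open>c\<close> in its other endpoint.\<close>
        have "edge_adj e (a c)"
          using edge_adj_via_other_endpoint[of c v e "a c"] False e ac ce c \<open>v \<in> c\<close> card_edge[OF G]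
          unfolding E_H by blast
        then show ?thesis
          using in_S by blast
      qed
    qed
  qed
  have "tde_chromatic_number H \<le> card S + card (f ` (edges H - S))"
    using proper dom
    by (intro tde_chromatic_number_le_single_out finH) (auto simp: S_def E_H)
  also have "\<dots> \<le> card S + card (f ` edges H)"
    using finH by (intro add_left_mono card_mono) auto
  also have "\<dots> \<le> tde_chromatic_number G + degree G v"
    using card_S lost K_deg by linarith
  finally show ?thesis
    by (simp add: H_def)
qed

section \<open>The two-sided bound\<close>

theorem theorem3p2:
  fixes G :: "'a sgraph" and v :: 'a
  assumes "simple_graph G"
    and "connected_graph G"
    and "v \<in> verts G"
    and "\<not> cut_vertex G v"
    and "tde_colorable G"
    and "tde_colorable (delete_vertex G v)"
  shows "int (tde_chromatic_number G) - int (degree G v)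
           \<le> int (tde_chromatic_number (delete_vertex G v)) \<and>
         int (tde_chromatic_number (delete_vertex G v))
           \<le> int (tde_chromatic_number G) + int (degree G v)"
  using tde_chromatic_number_le_delete_vertex[OF assms(1,5,6)]
    tde_chromatic_number_delete_vertex_le[OF assms(1,5,6)]
  by linarith

end
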